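(* Let $\mathscr C$ be a class of graphs of bounded expansion. Then $\mathscr C$ has bounded strong odd chromatic number, i.e., there exists $c\in\mathbb{N}$ such that every $G\in\mathscr C$ has strong odd chromatic number at most $c$.
   Context: All graphs are finite, simple and undirected. A proper coloring of $G$ is a map $\phi\colon V(G)\to C$ (finite palette $C$) with $\phi(u)\neq\phi(v)$ for every edge $uv$. A strong odd coloring of $G$ is a proper coloring $\phi$ such that for every vertex $u$ and every color $i\in C$, the number of neighbors of $u$ of color $i$ is either zero or odd. The strong odd chromatic number of $G$ is the minimum number of colors in a strong odd coloring of $G$. For $d\in\mathbb{N}$, a graph $H$ is a depth-$d$ minor of $G$ if one can assign to each $u\in V(H)$ a connected subgraph $\eta(u)$ of $G$ of radius at most $d$, the subgraphs $\eta(u)$ pairwise vertex-disjoint, such that for each edge $uv$ of $H$ there is an edge of $G$ between $\eta(u)$ and $\eta(v)$. $\nabla_d(G)$ is the maximum average degree of a depth-$d$ minor of $G$. A graph class $\mathscr C$ has bounded expansion if for every $d\in\mathbb{N}$ there is a constant bounding $\nabla_d(G)$ for all $G\in\mathscr C$. *)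

theory Defs
  imports
    Complex_Main
    "HOL-Library.FuncSet"
    "Graph_Theory.Graph_Theory"
begin

text \<open>
  A finite simple undirected graph is a record of type \<^typ>\<open>'a pair_pre_digraph\<close> satisfying the predicate \<^const>\<open>pair_graph\<close>: the
  vertex set is finite, and an edge \<open>uv\<close> is represented by the two arcs \<open>(u, v)\<close> and \<open>(v, u)\<close>.
\<close>

definition neighbors :: "'a pair_pre_digraph \<Rightarrow> 'a \<Rightarrow> 'a set" where
  "neighbors G u = {v. (u, v) \<in> parcs G}"

definition average_degree :: "'a pair_pre_digraph \<Rightarrow> real" where
  "average_degree G = (\<Sum>u\<in>pverts G. real (card (neighbors G u))) / real (card (pverts G))"


subsection \<open>Strong odd colorings\<close>

definition proper_coloring :: "'a pair_pre_digraph \<Rightarrow> 'c set \<Rightarrow> ('a \<Rightarrow> 'c) \<Rightarrow> bool" where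
  "proper_coloring G C \<phi> \<longleftrightarrow>
     finite C \<and> \<phi> \<in> pverts G \<rightarrow> C \<and> (\<forall>(u, v) \<in> parcs G. \<phi> u \<noteq> \<phi> v)"

definition strong_odd_coloring :: "'a pair_pre_digraph \<Rightarrow> 'c set \<Rightarrow> ('a \<Rightarrow> 'c) \<Rightarrow> bool" where
  "strong_odd_coloring G C \<phi> \<longleftrightarrow>
     proper_coloring G C \<phi> \<and>
     (\<forall>u \<in> pverts G. \<forall>i \<in> C.
        card {v \<in> neighbors G u. \<phi> v = i} = 0 \<or> odd (card {v \<in> neighbors G u. \<phi> v = i}))"

text \<open>Only the size of the palette matters, so palettes consisting of natural numbers suffice.\<close>

definition strong_odd_chromatic_number :: "'a pair_pre_digraph \<Rightarrow> nat" where
  "strong_odd_chromatic_number G =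
     (LEAST k. \<exists>(C :: nat set) \<phi>. strong_odd_coloring G C \<phi> \<and> card C = k)"


subsection \<open>Shallow minors and bounded expansion\<close>

text \<open>With unit weights, \<^const>\<open>wf_digraph.\<mu>\<close> is the usual distance (\<open>\<infinity>\<close> if there is no walk).\<close>

definition graph_dist :: "'a pair_pre_digraph \<Rightarrow> 'a \<Rightarrow> 'a \<Rightarrow> ereal" where
  "graph_dist G u v = wf_digraph.\<mu> (with_proj G) (\<lambda>_. 1) u v"

definition radius :: "'a pair_pre_digraph \<Rightarrow> ereal" where
  "radius G = (INF c\<in>pverts G. SUP v\<in>pverts G. graph_dist G c v)"

definition depth_minor :: "nat \<Rightarrow> 'b pair_pre_digraph \<Rightarrow> 'a pair_pre_digraph \<Rightarrow> bool" where
  "depth_minor d H G \<longleftrightarrow>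
     pair_graph H \<and>
     (\<exists>\<eta> :: 'b \<Rightarrow> 'a pair_pre_digraph.
        (\<forall>u \<in> pverts H. pair_graph (\<eta> u) \<and> subgraph (with_proj (\<eta> u)) (with_proj G) \<and>
           Digraph_Component.connected (with_proj (\<eta> u)) \<and> radius (\<eta> u) \<le> ereal (real d)) \<and>
        (\<forall>u \<in> pverts H. \<forall>v \<in> pverts H. u \<noteq> v \<longrightarrow> pverts (\<eta> u) \<inter> pverts (\<eta> v) = {}) \<and>
        (\<forall>(u, v) \<in> parcs H. \<exists>x \<in> pverts (\<eta> u). \<exists>y \<in> pverts (\<eta> v). (x, y) \<in> parcs G))"

text \<open>
  Minors are taken with natural numbers as vertices, which covers every finite graph up to
  isomorphism. The maximum is attained: see \<open>finite_minor_degrees\<close> and \<open>minor_degrees_nonempty\<close>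
  below. The average degree of the empty graph is \<open>0 / 0 = 0\<close>.
\<close>

definition nabla :: "nat \<Rightarrow> 'a pair_pre_digraph \<Rightarrow> real" where
  "nabla d G = Max {average_degree H | H :: nat pair_pre_digraph. depth_minor d H G}"

definition bounded_expansion :: "'a pair_pre_digraph set \<Rightarrow> bool" where
  "bounded_expansion \<C> \<longleftrightarrow> (\<forall>d. \<exists>c :: real. \<forall>G \<in> \<C>. nabla d G \<le> c)"


subsection \<open>Well-definedness\<close>

lemma graph_dist_le_iff:
  "graph_dist G u v \<le> ereal (real d)
     \<longleftrightarrow> (\<exists>p. pre_digraph.awalk (with_proj G) u p v \<and> length p \<le> d)"
  if "pair_graph G"
proof -
  interpret pair_graph G by fact
  have cost: "awalk_cost (\<lambda>_. 1) p = real (length p)" for p :: "('a \<times> 'a) list"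
    by (induct p) (simp_all add: awalk_cost_def)
  show ?thesis
  proof
    assume "graph_dist G u v \<le> ereal (real d)"
    also have "ereal (real d) < ereal (real d + 1)" by simp
    finally have "(INF p\<in>{p. awalk u p v}. ereal (awalk_cost (\<lambda>_. 1) p)) < ereal (real d + 1)"
      by (simp add: graph_dist_def \<mu>_def)
    then obtain p where "awalk u p v" "ereal (awalk_cost (\<lambda>_. 1) p) < ereal (real d + 1)"
      by (auto simp: INF_less_iff)
    then show "\<exists>p. awalk u p v \<and> length p \<le> d"
      by (intro exI[of _ p]) (simp add: cost)
  next
    assume "\<exists>p. awalk u p v \<and> length p \<le> d"
    then obtain p where p: "awalk u p v" "length p \<le> d" by blast
    have "\<mu> (\<lambda>_. 1) u v \<le> ereal (awalk_cost (\<lambda>_. 1) p)"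
      by (rule min_cost_le_walk_cost) (rule p)
    also have "\<dots> \<le> ereal (real d)" using p(2) by (simp add: cost)
    finally show "graph_dist G u v \<le> ereal (real d)" by (simp add: graph_dist_def)
  qed
qed

lemma radius_le_iff:
  "radius G \<le> ereal (real d) \<longleftrightarrow>
     (\<exists>c \<in> pverts G. \<forall>v \<in> pverts G. \<exists>p. pre_digraph.awalk (with_proj G) c p v \<and> length p \<le> d)"
  if "pair_graph G"
proof -
  interpret pair_graph G by fact
  have fin: "finite (pverts G)" by (rule pair_finite_verts)
  have "radius G \<le> ereal (real d) \<longleftrightarrow>
      (\<exists>c \<in> pverts G. (SUP v\<in>pverts G. graph_dist G c v) \<le> ereal (real d))"
  proof (cases "pverts G = {}")
    case True
    then show ?thesis by (simp add: radius_def top_ereal_def)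
  next
    case False
    then have "radius G \<in> (\<lambda>c. SUP v\<in>pverts G. graph_dist G c v) ` pverts G"
      unfolding radius_def using fin by (subst cInf_eq_Min) (auto intro!: Min_in)
    then show ?thesis
      by (auto simp: radius_def intro: INF_lower2)
  qed
  also have "\<dots> \<longleftrightarrow> (\<exists>c \<in> pverts G. \<forall>v \<in> pverts G. graph_dist G c v \<le> ereal (real d))"
    by (simp add: SUP_le_iff)
  finally show ?thesis using that by (simp add: graph_dist_le_iff)
qed

lemma ex_strong_odd_coloring:
  assumes "pair_graph G"
  shows "\<exists>(C :: nat set) \<phi>. strong_odd_coloring G C \<phi>"
proof -
  interpret pair_graph G by fact
  obtain \<phi> :: "'a \<Rightarrow> nat" where inj: "inj_on \<phi> (pverts G)"
    using finite_imp_inj_to_nat_seg[OF pair_finite_verts] by blast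
  have "card {v \<in> neighbors G u. \<phi> v = i} = 0 \<or> odd (card {v \<in> neighbors G u. \<phi> v = i})" for u i
  proof (cases "{v \<in> neighbors G u. \<phi> v = i} = {}")
    case False
    then obtain w where w: "w \<in> neighbors G u" "\<phi> w = i" by blast
    have "{v \<in> neighbors G u. \<phi> v = i} = {w}"
      using w inj by (auto simp: neighbors_def inj_on_def dest: in_arcsD2)
    then show ?thesis by simp
  qed (simp only: card.empty, simp)
  moreover have "proper_coloring G (\<phi> ` pverts G) \<phi>"
    unfolding proper_coloring_def
  proof (intro conjI ballI)
    show "finite (\<phi> ` pverts G)" using pair_finite_verts by simp
    show "\<phi> \<in> pverts G \<rightarrow> \<phi> ` pverts G" by simp
    fix e assume e: "e \<in> parcs G"
    have "fst e \<in> pverts G" "snd e \<in> pverts G" "fst e \<noteq> snd e"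
      by (rule arc_fst_in_verts[OF e], rule arc_snd_in_verts[OF e], rule pair_no_loops[OF e])
    then have "\<phi> (fst e) \<noteq> \<phi> (snd e)" using inj by (simp add: inj_on_eq_iff)
    then show "case e of (u, v) \<Rightarrow> \<phi> u \<noteq> \<phi> v" by (simp add: case_prod_beta)
  qed
  ultimately have "strong_odd_coloring G (\<phi> ` pverts G) \<phi>"
    unfolding strong_odd_coloring_def by simp
  then show ?thesis by blast
qed

lemma strong_odd_chromatic_number_le_iff:
  assumes "pair_graph G"
  shows "strong_odd_chromatic_number G \<le> c
    \<longleftrightarrow> (\<exists>(C :: nat set) \<phi>. strong_odd_coloring G C \<phi> \<and> card C \<le> c)"
proof
  assume le: "strong_odd_chromatic_number G \<le> c"
  have "\<exists>(C :: nat set) \<phi>. strong_odd_coloring G C \<phi> \<and> card C = strong_odd_chromatic_number G"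
    unfolding strong_odd_chromatic_number_def
    by (rule LeastI_ex) (use ex_strong_odd_coloring[OF assms] in blast)
  with le show "\<exists>(C :: nat set) \<phi>. strong_odd_coloring G C \<phi> \<and> card C \<le> c" by metis
next
  assume "\<exists>(C :: nat set) \<phi>. strong_odd_coloring G C \<phi> \<and> card C \<le> c"
  then obtain C :: "nat set" and \<phi> where C: "strong_odd_coloring G C \<phi>" "card C \<le> c" by blast
  have "strong_odd_chromatic_number G \<le> card C"
    unfolding strong_odd_chromatic_number_def by (rule Least_le) (use C in blast)
  with C(2) show "strong_odd_chromatic_number G \<le> c" by simp
qed

lemma depth_minor_card_le:
  fixes G :: "'a pair_pre_digraph" and H :: "'b pair_pre_digraph"
  assumes "pair_graph G" "depth_minor d H G"
  shows "card (pverts H) \<le> card (pverts G)"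
proof -
  interpret G: pair_graph G by fact
  obtain \<eta> :: "'b \<Rightarrow> 'a pair_pre_digraph" where
    \<eta>: "\<forall>u \<in> pverts H. pair_graph (\<eta> u) \<and> subgraph (with_proj (\<eta> u)) (with_proj G) \<and>
           Digraph_Component.connected (with_proj (\<eta> u)) \<and> radius (\<eta> u) \<le> ereal (real d)"
    and disj: "\<forall>u \<in> pverts H. \<forall>v \<in> pverts H. u \<noteq> v \<longrightarrow> pverts (\<eta> u) \<inter> pverts (\<eta> v) = {}"
    using assms(2) unfolding depth_minor_def by blast
  have sub: "pverts (\<eta> u) \<subseteq> pverts G \<and> pverts (\<eta> u) \<noteq> {}" if "u \<in> pverts H" for u
  proof -
    have "subgraph (with_proj (\<eta> u)) (with_proj G)"
      "Digraph_Component.connected (with_proj (\<eta> u))"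
      using \<eta> that by blast+
    then show ?thesis
      by (simp add: subgraph_def Digraph_Component.connected_def strongly_connected_def
          mk_symmetric_def)
  qed
  define f where "f u = (SOME x. x \<in> pverts (\<eta> u))" for u
  have f: "f u \<in> pverts (\<eta> u)" if "u \<in> pverts H" for u
    unfolding f_def using sub[OF that] by (simp add: some_in_eq)
  have "inj_on f (pverts H)"
  proof (rule inj_onI, rule ccontr)
    fix u v assume uv: "u \<in> pverts H" "v \<in> pverts H" "f u = f v" "u \<noteq> v"
    then have "pverts (\<eta> u) \<inter> pverts (\<eta> v) = {}" using disj by blast
    moreover have "f u \<in> pverts (\<eta> u)" "f u \<in> pverts (\<eta> v)"
      using f[OF uv(1)] f[OF uv(2)] uv(3) by simp_all
    ultimately show False by blast
  qed
  moreover have "f ` pverts H \<subseteq> pverts G" using f sub by blast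
  ultimately show ?thesis using G.pair_finite_verts by (rule card_inj_on_le)
qed

lemma finite_minor_degrees:
  assumes "pair_graph G"
  shows "finite {average_degree H | H :: 'b pair_pre_digraph. depth_minor d H G}"
proof (rule finite_subset)
  let ?n = "card (pverts G)"
  show "finite ((\<lambda>(s, k). real s / real k) ` ({..?n * ?n} \<times> {..?n}))" by simp
  show "{average_degree H | H :: 'b pair_pre_digraph. depth_minor d H G}
      \<subseteq> (\<lambda>(s, k). real s / real k) ` ({..?n * ?n} \<times> {..?n})"
  proof safe
    fix H :: "'b pair_pre_digraph" assume H: "depth_minor d H G"
    then interpret H: pair_graph H by (simp add: depth_minor_def)
    have le: "card (pverts H) \<le> ?n" by (rule depth_minor_card_le[OF assms H])
    have "card (neighbors H u) \<le> card (pverts H)" for u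
      by (rule card_mono[OF H.pair_finite_verts]) (auto simp: neighbors_def dest: H.in_arcsD2)
    then have "(\<Sum>u\<in>pverts H. card (neighbors H u)) \<le> card (pverts H) * card (pverts H)"
      using sum_bounded_above[of "pverts H" "\<lambda>u. card (neighbors H u)" "card (pverts H)"] by simp
    also have "\<dots> \<le> ?n * ?n" using le by (rule mult_le_mono[OF _ le])
    finally have "(\<Sum>u\<in>pverts H. card (neighbors H u), card (pverts H)) \<in> {..?n * ?n} \<times> {..?n}"
      using le by simp
    then show "average_degree H \<in> (\<lambda>(s, k). real s / real k) ` ({..?n * ?n} \<times> {..?n})"
      by (rule rev_image_eqI) (simp add: average_degree_def)
  qed
qed

lemma minor_degrees_nonempty:
  "{average_degree H | H :: 'b pair_pre_digraph. depth_minor d H G} \<noteq> {}"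
proof -
  have "pair_graph (\<lparr>pverts = {}, parcs = {}\<rparr> :: 'b pair_pre_digraph)"
    by unfold_locales (auto simp: symmetric_def)
  then have "depth_minor d (\<lparr>pverts = {}, parcs = {}\<rparr> :: 'b pair_pre_digraph) G"
    by (simp add: depth_minor_def)
  then show ?thesis by blast
qed

lemma nabla_le_iff:
  assumes "pair_graph G"
  shows "nabla d G \<le> c \<longleftrightarrow>
    (\<forall>H :: nat pair_pre_digraph. depth_minor d H G \<longrightarrow> average_degree H \<le> c)"
  unfolding nabla_def
  by (subst Max_le_iff[OF finite_minor_degrees[OF assms] minor_degrees_nonempty]) blast

end

theory Submission
  imports Defs
begin

text \<open>
  Only minors of depth 2 matter. Orient \<open>G\<close> along a degeneracy order \<open>f1\<close>, so that each vertex has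
  boundedly many in-neighbours. The fraternal graph, joining two in-neighbours of a common vertex,
  is again degenerate; orient it along an order \<open>f2\<close>. The fraternal graph of that orientation is
  degenerate as well, so a bounded proper colouring \<open>c\<close> of all these graphs together exists.

  Give \<open>v\<close> the type consisting of \<open>c v\<close> and the list of colours of its in-neighbours, sorted by
  \<open>f2\<close>. Among vertices of one type the \<open>j\<close>-th in-neighbour determines the \<open>i\<close>-th one for \<open>i < j\<close>, so
  the out-neighbourhoods restricted to a type form a laminar family of bounded depth. Such a family
  can be split with \<open>2 ^ depth\<close> colours so that every member meets every colour in zero or an odd
  number of elements. An in-neighbour of \<open>u\<close> shares its colour \<open>c\<close> with no other neighbour of \<open>u\<close>,
  so the pairs (type, colour of the splitting) form a strong odd colouring.
\<close>

section \<open>Degeneracy orders and greedy colourings of relations that are sparse on every vertex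
  subset\<close>

text \<open>The in-degrees within \<open>V\<close> sum to the number of pairs of \<open>R\<close>
  inside \<open>V\<close>, so their average is at most \<open>m\<close>.\<close>

lemma ex_low_degree:
  assumes "finite V" "V \<noteq> {}" "card (R \<inter> V \<times> V) \<le> m * card V"
  shows "\<exists>x\<in>V. card {y \<in> V. (y, x) \<in> R} \<le> m"
proof (rule ccontr)
  assume "\<not> ?thesis"
  then have "(\<Sum>x\<in>V. m) < (\<Sum>x\<in>V. card {y \<in> V. (y, x) \<in> R})"
    using assms by (intro sum_strict_mono) (auto simp: not_le)
  also have "\<dots> = card (SIGMA x:V. {y \<in> V. (y, x) \<in> R})"
    using assms by (subst card_SigmaI) auto
  also have "\<dots> = card (R \<inter> V \<times> V)"
    by (rule bij_betw_same_card[of prod.swap])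
      (auto simp: bij_betw_def inj_on_def image_def)
  finally show False using assms by (simp add: mult.commute)
qed

text \<open>A vertex of in-degree at most \<open>m\<close> goes last and the rest is ordered by
  induction; the density hypothesis passes to subsets.\<close>

lemma degenerate_order:
  assumes "finite V" "\<And>W. W \<subseteq> V \<Longrightarrow> card (R \<inter> W \<times> W) \<le> m * card W"
  shows "\<exists>f :: 'a \<Rightarrow> nat. inj_on f V \<and> (\<forall>x\<in>V. card {y \<in> V. (y, x) \<in> R \<and> f y < f x} \<le> m)"
  using assms
proof (induction V rule: finite_psubset_induct)
  case (psubset V)
  show ?case
  proof (cases "V = {}")
    case False
    then obtain x where x: "x \<in> V" "card {y \<in> V. (y, x) \<in> R} \<le> m"
      using ex_low_degree[OF psubset.hyps(1)] psubset.prems[of V] by blast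
    have "V - {x} \<subset> V" using x by blast
    from psubset.IH[OF this psubset.prems]
    obtain f :: "'a \<Rightarrow> nat" where f: "inj_on f (V - {x})"
      "\<forall>z\<in>V - {x}. card {y \<in> V - {x}. (y, z) \<in> R \<and> f y < f z} \<le> m"
      by auto
    \<comment> \<open>The successor of the sum of all values of \<open>f\<close> exceeds each of
      them, so \<open>x\<close> comes last.\<close>
    define g where "g = f(x := Suc (sum f (V - {x})))"
    have less: "g y < g x" if "y \<in> V - {x}" for y
      using that psubset.hyps(1) member_le_sum[of y "V - {x}" f]
      by (auto simp: g_def less_Suc_eq_le)
    have eq: "g y = f y" if "y \<noteq> x" for y using that by (simp add: g_def)
    have "inj_on g V"
    proof (rule inj_onI)
      fix a b assume ab: "a \<in> V" "b \<in> V" "g a = g b"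
      show "a = b"
      proof (cases "a = x \<or> b = x")
        case True
        then show ?thesis using less[of a] less[of b] ab by fastforce
      next
        case False
        then show ?thesis using ab f(1) eq by (auto simp: inj_on_def)
      qed
    qed
    moreover have "card {y \<in> V. (y, z) \<in> R \<and> g y < g z} \<le> m" if z: "z \<in> V" for z
    proof (cases "z = x")
      case True
      have "card {y \<in> V. (y, x) \<in> R \<and> g y < g x} \<le> card {y \<in> V. (y, x) \<in> R}"
        using psubset.hyps(1) by (intro card_mono) auto
      then show ?thesis using True x by simp
    next
      case False
      have "{y \<in> V. (y, z) \<in> R \<and> g y < g z} = {y \<in> V - {x}. (y, z) \<in> R \<and> f y < f z}"
        using False z less[of z] eq[of z] eq by (auto; metis less_asym)
      then show ?thesis using f(2) z False by simp
    qed
    ultimately show ?thesis by blast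
  qed auto
qed

text \<open>A vertex with at most \<open>m\<close> neighbours is coloured after all others. Symmetry
  of \<open>R\<close> lets the bound on one direction control both.\<close>

lemma degenerate_coloring:
  assumes "finite V" "sym R" "\<And>W. W \<subseteq> V \<Longrightarrow> card (R \<inter> W \<times> W) \<le> m * card W"
  shows "\<exists>c :: 'a \<Rightarrow> nat. (\<forall>x\<in>V. c x \<le> m) \<and>
    (\<forall>x\<in>V. \<forall>y\<in>V. x \<noteq> y \<longrightarrow> (x, y) \<in> R \<longrightarrow> c x \<noteq> c y)"
  using assms(1,3)
proof (induction V rule: finite_psubset_induct)
  case (psubset V)
  show ?case
  proof (cases "V = {}")
    case False
    then obtain x where x: "x \<in> V" "card {y \<in> V. (y, x) \<in> R} \<le> m"
      using ex_low_degree[OF psubset.hyps(1)] psubset.prems[of V] by blast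
    obtain c :: "'a \<Rightarrow> nat" where c: "\<forall>z\<in>V - {x}. c z \<le> m"
      "\<forall>z\<in>V - {x}. \<forall>y\<in>V - {x}. z \<noteq> y \<longrightarrow> (z, y) \<in> R \<longrightarrow> c z \<noteq> c y"
      using psubset.IH[of "V - {x}"] psubset.prems x by blast
    \<comment> \<open>At most \<open>m\<close> values are blocked, while \<open>{..m}\<close> has
      \<open>m + 1\<close> elements.\<close>
    let ?N = "c ` {y \<in> V. (y, x) \<in> R}"
    have "card ?N < card {..m}"
      using x(2) card_image_le[of "{y \<in> V. (y, x) \<in> R}" c] psubset.hyps(1) by simp
    then have "\<not> {..m} \<subseteq> ?N"
      using card_mono[of ?N "{..m}"] psubset.hyps(1) by auto
    then obtain k where k: "k \<le> m" "k \<notin> ?N" by auto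
    have "\<forall>z\<in>V. (c(x := k)) z \<le> m" using c(1) k(1) by auto
    moreover have "(c(x := k)) z \<noteq> (c(x := k)) y"
      if "z \<in> V" "y \<in> V" "z \<noteq> y" "(z, y) \<in> R" for z y
    proof -
      have "(y, z) \<in> R" using that(4) by (rule symD[OF assms(2)])
      then show ?thesis using that c(2) k(2) by (cases "z = x"; cases "y = x") auto
    qed
    ultimately show ?thesis by blast
  qed auto
qed

section \<open>First-moment argument for random assignments\<close>

text \<open>
  A random assignment satisfies a constraint on at most \<open>k\<close> vertices with probability at least
  \<open>q\<close> to the power \<open>-k\<close>.
\<close>

lemma ex_assignment_satisfying_many:
  fixes L :: "'a \<Rightarrow> 'b set"
  assumes V: "finite V" and L: "\<And>u. u \<in> V \<Longrightarrow> finite (L u) \<and> L u \<noteq> {} \<and> card (L u) \<le> q"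
    and q: "1 \<le> q" and F: "finite F"
    and S: "\<And>e. e \<in> F \<Longrightarrow> S e \<subseteq> V \<and> card (S e) \<le> k \<and> (\<forall>u\<in>S e. p e u \<in> L u)"
  shows "\<exists>\<rho>\<in>Pi\<^sub>E V L. card F \<le> q ^ k * card {e \<in> F. \<forall>u\<in>S e. \<rho> u = p e u}"
proof (rule ccontr)
  assume neg: "\<not> ?thesis"
  let ?P = "Pi\<^sub>E V L"
  have finP: "finite ?P" using V L by (intro finite_PiE) auto
  have neP: "?P \<noteq> {}" using L by (simp add: PiE_eq_empty_iff)
  have each: "card ?P \<le> q ^ k * card {\<rho> \<in> ?P. \<forall>u\<in>S e. \<rho> u = p e u}" if e: "e \<in> F" for e
  proof -
    have SV: "S e \<subseteq> V" and Sk: "card (S e) \<le> k" and p: "\<forall>u\<in>S e. p e u \<in> L u"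
      using S[OF e] by auto
    \<comment> \<open>Satisfying \<open>e\<close> pins the coordinates in \<open>S e\<close> and
      leaves the others free, so the factor lost is the product of the at most \<open>k\<close>
      pinned list sizes.\<close>
    let ?Q = "Pi\<^sub>E V (\<lambda>u. if u \<in> S e then {p e u} else L u)"
    have "{\<rho> \<in> ?P. \<forall>u\<in>S e. \<rho> u = p e u} = ?Q"
      using SV p by (fastforce simp: PiE_iff split: if_splits)
    moreover have "card ?Q = (\<Prod>u\<in>V - S e. card (L u))"
      using V SV by (simp add: card_PiE prod.subset_diff[OF SV V])
    moreover have "card ?P = (\<Prod>u\<in>V - S e. card (L u)) * (\<Prod>u\<in>S e. card (L u))"
      using V SV by (simp add: card_PiE prod.subset_diff[OF SV V])
    moreover have "(\<Prod>u\<in>S e. card (L u)) \<le> q ^ k"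
    proof -
      have "(\<Prod>u\<in>S e. card (L u)) \<le> (\<Prod>u\<in>S e. q)"
        using L SV by (intro prod_mono) auto
      also have "\<dots> \<le> q ^ k" using q Sk by (simp add: power_increasing)
      finally show ?thesis .
    qed
    ultimately show ?thesis by (simp add: mult.commute)
  qed
  \<comment> \<open>Pairs of an assignment and a constraint satisfied by it are counted in two ways;
    if every assignment fell short, the total would be too small.\<close>
  have "card ?P * card F = (\<Sum>e\<in>F. card ?P)" by simp
  also have "\<dots> \<le> (\<Sum>e\<in>F. q ^ k * card {\<rho> \<in> ?P. \<forall>u\<in>S e. \<rho> u = p e u})"
    by (intro sum_mono each)
  also have "\<dots> = q ^ k * (\<Sum>e\<in>F. card {\<rho> \<in> ?P. \<forall>u\<in>S e. \<rho> u = p e u})"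
    by (simp add: sum_distrib_left)
  also have "(\<Sum>e\<in>F. card {\<rho> \<in> ?P. \<forall>u\<in>S e. \<rho> u = p e u})
      = (\<Sum>\<rho>\<in>?P. card {e \<in> F. \<forall>u\<in>S e. \<rho> u = p e u})"
    using sum.swap_restrict[OF F finP, of "\<lambda>_ _. 1::nat" "\<lambda>e \<rho>. \<forall>u\<in>S e. \<rho> u = p e u"] by simp
  also have "q ^ k * \<dots> = (\<Sum>\<rho>\<in>?P. q ^ k * card {e \<in> F. \<forall>u\<in>S e. \<rho> u = p e u})"
    by (simp add: sum_distrib_left)
  also have "\<dots> < (\<Sum>\<rho>\<in>?P. card F)"
    using neg finP neP by (intro sum_strict_mono) (auto simp: not_le)
  finally show False by simp
qed

section \<open>Splitting laminar families into odd parts\<close>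

text \<open>Note the order of the arguments: the second function is the finer one.\<close>

definition refines_on :: "'a set \<Rightarrow> ('a \<Rightarrow> 'b) \<Rightarrow> ('a \<Rightarrow> 'b) \<Rightarrow> bool" where
  "refines_on A g g' \<longleftrightarrow> (\<forall>x\<in>A. \<forall>y\<in>A. g' x = g' y \<longrightarrow> g x = g y)"

text \<open>The list runs from coarse to fine. For an injective function one colour suffices; each
  coarser function put in front splits every colour into at most two, which repairs its own even
  classes and leaves the classes of the finer functions whole.\<close>

lemma odd_partition_of_refining_chain:
  fixes gs :: "('a \<Rightarrow> 'b) list"
  assumes "finite A" "gs \<noteq> []" "inj_on (last gs) A"
    "sorted_wrt (refines_on A) gs"
  shows "\<exists>h :: 'a \<Rightarrow> nat. (\<forall>x\<in>A. h x < 2 ^ (length gs - 1)) \<and>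
    (\<forall>g\<in>set gs. \<forall>u i. {x \<in> A. g x = u \<and> h x = i} = {} \<or> odd (card {x \<in> A. g x = u \<and> h x = i}))"
  using assms(2-)
proof (induction gs rule: list_nonempty_induct)
  case (single g)
  have "{x \<in> A. g x = u \<and> 0 = i} = {} \<or> odd (card {x \<in> A. g x = u \<and> 0 = i})" for u and i :: nat
  proof (cases "{x \<in> A. g x = u \<and> 0 = i} = {}")
    case False
    then obtain w where "w \<in> A" "g w = u" "i = 0" by auto
    then have "{x \<in> A. g x = u \<and> 0 = i} = {w}" using single by (auto simp: inj_on_def)
    then show ?thesis by simp
  qed simp
  then show ?case by (intro exI[of _ "\<lambda>_. 0"]) auto
next
  case (cons g gs)
  obtain h :: "'a \<Rightarrow> nat" where h: "\<forall>x\<in>A. h x < 2 ^ (length gs - 1)"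
    "\<forall>g\<in>set gs. \<forall>u i. {x \<in> A. g x = u \<and> h x = i} = {} \<or> odd (card {x \<in> A. g x = u \<and> h x = i})"
    using cons by auto
  define g2 where "g2 = hd gs"
  have g2_in: "g2 \<in> set gs" using cons.hyps by (simp add: g2_def)
  have refine: "g2 x = g2 y" if "g' \<in> set gs" "x \<in> A" "y \<in> A" "g' x = g' y" for g' x y
  proof (cases "g' = g2")
    case False
    obtain gs' where gs': "gs = g2 # gs'" using cons.hyps by (cases gs) (auto simp: g2_def)
    then have "refines_on A g2 g'"
      using cons.prems(2) that(1) False by simp
    then show ?thesis using that unfolding refines_on_def by blast
  qed (use that in simp)
  have refine2: "g x = g y" if "x \<in> A" "y \<in> A" "g2 x = g2 y" for x y
  proof -
    have "refines_on A g g2" using cons.prems(2) g2_in by simp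
    then show ?thesis using that unfolding refines_on_def by blast
  qed
  define bad where "bad u i \<longleftrightarrow> {x \<in> A. g x = u \<and> h x = i} \<noteq> {} \<and> even (card {x \<in> A. g x = u \<and> h x = i})" for u i
  \<comment> \<open>The choice matters only through its \<open>g2\<close>-fibre, the one that will
    be moved.\<close>
  define pick where "pick u i = (SOME x. x \<in> A \<and> g x = u \<and> h x = i)" for u i
  have pick: "pick u i \<in> A \<and> g (pick u i) = u \<and> h (pick u i) = i" if "bad u i" for u i
    unfolding pick_def by (rule someI_ex) (use that in \<open>auto simp: bad_def\<close>)
  \<comment> \<open>One fibre of \<open>g2\<close> in each bad class moves to a new colour; it has an odd number of elements,
    so an odd number remains.\<close>
  define flag where "flag x \<longleftrightarrow> bad (g x) (h x) \<and> g2 x = g2 (pick (g x) (h x))" for x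
  define h' where "h' x = 2 * h x + of_bool (flag x)" for x
  have h'_eq: "h' x = i \<longleftrightarrow> h x = i div 2 \<and> (flag x \<longleftrightarrow> odd i)" for x i
    by (cases "flag x"; simp add: h'_def; presburger)
  have "h' x < 2 ^ (length (g # gs) - 1)" if "x \<in> A" for x
  proof -
    have "h x + 1 \<le> 2 ^ (length gs - 1)" using h(1) that by fastforce
    then have "2 * h x + 2 \<le> 2 * 2 ^ (length gs - 1)" by linarith
    also have "2 * 2 ^ (length gs - 1) = (2 :: nat) ^ length gs"
      using cons.hyps by (cases gs) auto
    finally show ?thesis by (simp add: h'_def of_bool_def)
  qed
  moreover have "{x \<in> A. g' x = u \<and> h' x = i} = {} \<or> odd (card {x \<in> A. g' x = u \<and> h' x = i})"
    if g': "g' \<in> set gs" for g' u i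
  proof -
    \<comment> \<open>As \<open>g'\<close> is at least as fine as \<open>g2\<close>, and
      \<open>g2\<close> finer than \<open>g\<close>, each class of \<open>g'\<close> and
      \<open>h\<close> moves as a whole or stays.\<close>
    have const: "flag x = flag y" if "x \<in> A" "y \<in> A" "g' x = g' y" "h x = h y" for x y
    proof -
      have "g2 x = g2 y" using refine g' that by blast
      moreover from this have "g x = g y" using refine2 that by blast
      ultimately show ?thesis using that by (simp add: flag_def)
    qed
    have "{x \<in> A. g' x = u \<and> h' x = i} = {} \<or>
        {x \<in> A. g' x = u \<and> h' x = i} = {x \<in> A. g' x = u \<and> h x = i div 2}"
    proof (cases "{x \<in> A. g' x = u \<and> h' x = i} = {}")
      case False
      then obtain w where w: "w \<in> A" "g' w = u" "h w = i div 2" "flag w \<longleftrightarrow> odd i"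
        by (auto simp: h'_eq)
      have "flag x \<longleftrightarrow> odd i" if "x \<in> A" "g' x = u" "h x = i div 2" for x
        using const[of x w] that w by simp
      then show ?thesis unfolding h'_eq by blast
    qed simp
    then show ?thesis
    proof
      assume "{x \<in> A. g' x = u \<and> h' x = i} = {x \<in> A. g' x = u \<and> h x = i div 2}"
      then show ?thesis using h(2)[rule_format, OF g'] by simp
    qed simp
  qed
  moreover have "{x \<in> A. g x = u \<and> h' x = i} = {} \<or> odd (card {x \<in> A. g x = u \<and> h' x = i})" for u i
  proof (cases "bad u (i div 2)")
    case False
    then have "\<not> flag x" if "g x = u" "h x = i div 2" for x using that by (simp add: flag_def)
    then have "{x \<in> A. g x = u \<and> h' x = i} = {} \<or>
        {x \<in> A. g x = u \<and> h' x = i} = {x \<in> A. g x = u \<and> h x = i div 2}"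
      unfolding h'_eq by (cases "odd i") auto
    then show ?thesis using False by (auto simp: bad_def)
  next
    case True
    let ?p = "pick u (i div 2)"
    let ?T = "{x \<in> A. g x = u \<and> h x = i div 2}"
    let ?Z = "{x \<in> A. g2 x = g2 ?p \<and> h x = i div 2}"
    have p: "?p \<in> A" "g ?p = u" "h ?p = i div 2" using pick[OF True] by auto
    have Z: "odd (card ?Z)" using h(2) g2_in p by blast
    have flag: "flag x \<longleftrightarrow> g2 x = g2 ?p" if "g x = u" "h x = i div 2" for x
      using that True by (simp add: flag_def)
    have gu: "g x = u" if "x \<in> A" "g2 x = g2 ?p" for x
      using refine2[OF that(1) p(1) that(2)] p(2) by (rule trans)
    then have ZT: "?Z \<subseteq> ?T" by blast
    have odd_case: "{x \<in> A. g x = u \<and> h' x = i} = ?Z" if "odd i"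
      unfolding h'_eq using that flag gu by blast
    have even_case: "{x \<in> A. g x = u \<and> h' x = i} = ?T - ?Z" if "even i"
      unfolding h'_eq using that flag by blast
    have "odd (card (?T - ?Z))"
    proof -
      have "card (?T - ?Z) = card ?T - card ?Z" "card ?Z \<le> card ?T"
        using assms(1) ZT by (auto intro!: card_Diff_subset card_mono)
      moreover have "even (card ?T)" using True by (simp add: bad_def)
      ultimately show ?thesis using Z by simp
    qed
    then show ?thesis using odd_case even_case Z by (cases "odd i") simp_all
  qed
  ultimately show ?case by (intro exI[of _ h']) auto
qed

section \<open>Density of depth-2 minors and of the augmented graphs\<close>

lemma pair_graph_sym: "(y, x) \<in> parcs G" if "pair_graph G" "(x, y) \<in> parcs G"
proof -
  interpret pair_graph G by fact
  have "sym (parcs G)" using sym_arcs by (simp add: symmetric_def)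
  then show ?thesis using that by (auto dest: symD)
qed

lemma pair_graphI:
  assumes "finite (pverts H)" "parcs H \<subseteq> pverts H \<times> pverts H" "sym (parcs H)" "irrefl (parcs H)"
  shows "pair_graph H"
  using assms by unfold_locales
    (auto simp: symmetric_def irrefl_def intro: finite_subset[OF assms(2)])

lemma sum_card_neighbors:
  assumes "pair_graph H"
  shows "(\<Sum>u\<in>pverts H. card (neighbors H u)) = card (parcs H)"
proof -
  interpret pair_graph H by fact
  have "neighbors H u \<subseteq> pverts H" for u by (auto simp: neighbors_def dest: in_arcsD2)
  then have "finite (neighbors H u)" for u using pair_finite_verts finite_subset by blast
  then have "(\<Sum>u\<in>pverts H. card (neighbors H u)) = card (SIGMA u:pverts H. neighbors H u)"
    using pair_finite_verts by (subst card_SigmaI) auto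
  also have "(SIGMA u:pverts H. neighbors H u) = parcs H"
    by (auto simp: neighbors_def dest: in_arcsD1)
  finally show ?thesis .
qed

text \<open>Contracting the sets \<open>B x\<close> turns \<open>F\<close> into arcs of a minor,
  whose average degree is at most \<open>m\<close>. The paths inside \<open>B x\<close> required by
  \<open>rad\<close> give connectedness and radius at most 2 around \<open>x\<close>.\<close>

lemma depth_2_minor_density:
  fixes G :: "'a pair_pre_digraph"
  assumes G: "pair_graph G" and m: "nabla 2 G \<le> real m"
    and BV: "\<And>x. x \<in> W \<Longrightarrow> x \<in> B x \<and> B x \<subseteq> pverts G"
    and disj: "\<And>x y. x \<in> W \<Longrightarrow> y \<in> W \<Longrightarrow> x \<noteq> y \<Longrightarrow> B x \<inter> B y = {}"
    and rad: "\<And>x z. x \<in> W \<Longrightarrow> z \<in> B x \<Longrightarrow> z = x \<or> (x, z) \<in> parcs G \<or>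
      (\<exists>v\<in>B x. (x, v) \<in> parcs G \<and> (v, z) \<in> parcs G)"
    and FW: "F \<subseteq> W \<times> W"
    and F: "\<And>x y. (x, y) \<in> F \<Longrightarrow> x \<noteq> y \<and> (\<exists>z\<in>B x. \<exists>z'\<in>B y. (z, z') \<in> parcs G)"
  shows "card F \<le> m * card W"
proof -
  interpret G: pair_graph G by fact
  have WV: "W \<subseteq> pverts G" using BV by blast
  then have finW: "finite W" using G.pair_finite_verts by (rule finite_subset)
  \<comment> \<open>\<open>nabla\<close> ranges over minors on natural numbers, so \<open>W\<close>
    is numbered.\<close>
  obtain e :: "'a \<Rightarrow> nat" where e: "inj_on e W"
    using finite_imp_inj_to_nat_seg[OF finW] by blast
  \<comment> \<open>\<open>F\<close> need not be symmetric; adding its converse yields a graph and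
    cannot lower the number of arcs.\<close>
  define H where "H = \<lparr>pverts = e ` W, parcs = map_prod e e ` (F \<union> F\<inverse>)\<rparr>"
  define K where "K x = \<lparr>pverts = B x, parcs = parcs G \<inter> B x \<times> B x\<rparr>" for x
  have pK [simp]: "pverts (K x) = B x" "parcs (K x) = parcs G \<inter> B x \<times> B x" for x
    by (simp_all add: K_def)
  define r where "r = the_inv_into W e"
  have r: "r (e x) = x" if "x \<in> W" for x using that e by (simp add: r_def the_inv_into_f_f)
  have H: "pair_graph H"
  proof (rule pair_graphI)
    show "finite (pverts H)" using finW by (simp add: H_def)
    show "parcs H \<subseteq> pverts H \<times> pverts H" using FW by (auto simp: H_def)
    show "sym (parcs H)" by (rule symI) (auto simp: H_def intro: rev_image_eqI)
    show "irrefl (parcs H)"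
    proof (rule irreflI)
      fix n
      show "(n, n) \<notin> parcs H"
      proof
        assume "(n, n) \<in> parcs H"
        then obtain x y where xy: "(x, y) \<in> F" "e x = e y" by (force simp: H_def)
        then show False using F[OF xy(1)] FW e by (auto dest: inj_onD)
      qed
    qed
  qed
  have K: "pair_graph (K x)" if "x \<in> W" for x
  proof (rule pair_graphI)
    show "finite (pverts (K x))"
      using BV[OF that] G.pair_finite_verts by (auto intro: finite_subset)
    show "sym (parcs (K x))"
      by (rule symI) (auto intro: pair_graph_sym[OF G])
    show "irrefl (parcs (K x))" using G.pair_no_loops by (fastforce simp: irrefl_def)
  qed auto
  have walk: "\<exists>p. pre_digraph.awalk (with_proj (K x)) x p z \<and> length p \<le> 2"
    if x: "x \<in> W" and z: "z \<in> B x" for x z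
  proof -
    interpret K: pair_graph "K x" using K[OF x] .
    have xB: "x \<in> B x" using BV x by blast
    consider "z = x" | "(x, z) \<in> parcs G"
      | v where "v \<in> B x" "(x, v) \<in> parcs G" "(v, z) \<in> parcs G"
      using rad[OF x z] by blast
    then show ?thesis
    proof cases
      case 1
      then show ?thesis using xB by (intro exI[of _ "[]"]) (simp add: K.awalk_simps)
    next
      case 2
      then show ?thesis using xB z
        by (intro exI[of _ "[(x, z)]"]) (simp add: K.awalk_simps)
    next
      case 3
      then show ?thesis using xB z
        by (intro exI[of _ "[(x, v), (v, z)]"]) (simp add: K.awalk_simps)
    qed
  qed
  have K_sub: "subgraph (with_proj (K x)) (with_proj G)" if "x \<in> W" for x
  proof -
    interpret K: pair_graph "K x" using K[OF that] .
    show ?thesis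
      using BV[OF that] G.wf_digraph K.wf_digraph
      by (auto simp: subgraph_def compatible_def)
  qed
  have K_conn: "Digraph_Component.connected (with_proj (K x))" if x: "x \<in> W" for x
  proof -
    interpret K: pair_graph "K x" using K[OF x] .
    have "x \<rightarrow>\<^sup>*\<^bsub>K x\<^esub> z" if "z \<in> B x" for z
      using walk[OF x that] K.reachable_awalk by auto
    \<comment> \<open>Reachability is symmetric, so any two vertices are joined through the centre
      \<open>x\<close>.\<close>
    then have "u \<rightarrow>\<^sup>*\<^bsub>K x\<^esub> v" if "u \<in> B x" "v \<in> B x" for u v
      using that K.symmetric_reachable' K.reachable_trans by blast
    then have "u \<rightarrow>\<^sup>*\<^bsub>mk_symmetric (K x)\<^esub> v" if "u \<in> B x" "v \<in> B x" for u v
      using that K.reachable_mk_symmetricI by blast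
    then show ?thesis using BV[OF x]
      by (auto simp: Digraph_Component.connected_def strongly_connected_def mk_symmetric_def)
  qed
  have K_rad: "radius (K x) \<le> ereal (real 2)" if x: "x \<in> W" for x
    unfolding radius_le_iff[OF K[OF x]] using walk[OF x] BV[OF x]
    by (intro bexI[of _ x]) auto
  have "depth_minor 2 H G"
    unfolding depth_minor_def
  proof (intro conjI exI[of _ "\<lambda>n. K (r n)"] ballI impI)
    fix u v assume uv: "u \<in> pverts H" "v \<in> pverts H" "u \<noteq> v"
    then obtain x y where "u = e x" "v = e y" "x \<in> W" "y \<in> W" by (auto simp: H_def)
    then show "pverts (K (r u)) \<inter> pverts (K (r v)) = {}"
      using disj[of x y] uv(3) by (auto simp: r)
  next
    fix a assume "a \<in> parcs H"
    then obtain x y where xy: "a = (e x, e y)" "(x, y) \<in> F \<union> F\<inverse>" by (auto simp: H_def)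
    then have "x \<in> W" "y \<in> W" using FW by auto
    moreover have "\<exists>z\<in>B x. \<exists>z'\<in>B y. (z, z') \<in> parcs G"
      using xy(2) F pair_graph_sym[OF G] by blast
    ultimately show "case a of (u, v) \<Rightarrow> \<exists>x\<in>pverts (K (r u)). \<exists>y\<in>pverts (K (r v)). (x, y) \<in> parcs G"
      by (simp add: xy(1) r)
  next
    show "pair_graph H" by (fact H)
  next
    fix u assume "u \<in> pverts H"
    then have "r u \<in> W" by (auto simp: H_def r)
    then show "pair_graph (K (r u))" "subgraph (with_proj (K (r u))) (with_proj G)"
      "Digraph_Component.connected (with_proj (K (r u)))" "radius (K (r u)) \<le> ereal (real 2)"
      by (fact K K_sub K_conn K_rad)+
  qed
  then have avg: "average_degree H \<le> real m"
    using m unfolding nabla_le_iff[OF G] by blast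
  have finF: "finite F" using FW finW by (meson finite_SigmaI finite_subset)
  have card_H: "card (pverts H) = card W" using e by (simp add: H_def card_image)
  have "inj_on (map_prod e e) (F \<union> F\<inverse>)"
    by (rule inj_on_subset[OF map_prod_inj_on[OF e e]]) (use FW in auto)
  then have "card (parcs H) = card (F \<union> F\<inverse>)" by (simp add: H_def card_image)
  then have "card F \<le> card (parcs H)" using finF by (simp add: card_mono)
  moreover have "real (card (parcs H)) \<le> real (m * card W)"
  \<comment> \<open>For empty \<open>W\<close> the average degree is \<open>0 / 0 = 0\<close> and
    bounds nothing, but then there are no arcs.\<close>
  proof (cases "card W = 0")
    case True
    then have "F = {}" using finW FW by simp
    then show ?thesis by (simp add: H_def)
  next
    case False
    have "real (card (parcs H)) / real (card W) \<le> real m"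
      using avg sum_card_neighbors[OF H] card_H
      by (simp add: average_degree_def flip: of_nat_sum)
    then show ?thesis using False by (simp add: field_simps)
  qed
  ultimately show ?thesis by linarith
qed

text \<open>
  Assign a random role to every vertex: to be a centre, to join the branch set of one of its
  in-neighbours in \<open>in1\<close>, or to join that of some \<open>x\<close> in \<open>in2\<close> through the connecting vertex \<open>mid x w\<close>.
  A pair in \<open>F\<close> becomes an edge of the resulting depth-2 minor as soon as the at most five vertices
  on its connecting path get the right roles.
\<close>

lemma density_of_augmentation:
  fixes G :: "'a pair_pre_digraph" and in1 in2 :: "'a \<Rightarrow> 'a set" and mid :: "'a \<Rightarrow> 'a \<Rightarrow> 'a"
  assumes G: "pair_graph G" and m: "nabla 2 G \<le> real m"
    and in1: "\<And>v x. x \<in> in1 v \<Longrightarrow> (x, v) \<in> parcs G"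
    and k1: "\<And>v. v \<in> pverts G \<Longrightarrow> card (in1 v) \<le> k1"
    and in2: "\<And>w x. x \<in> in2 w \<Longrightarrow> x \<noteq> w \<and> x \<in> in1 (mid x w) \<and> w \<in> in1 (mid x w)"
    and k2: "\<And>w. w \<in> pverts G \<Longrightarrow> card (in2 w) \<le> k2"
    and W: "W \<subseteq> pverts G" and FW: "F \<subseteq> W \<times> W"
    and F: "\<And>x y. (x, y) \<in> F \<Longrightarrow> x \<noteq> y \<and>
      ((\<exists>v. x \<in> in1 v \<and> (v, y) \<in> parcs G) \<or>
       (\<exists>w. x \<in> in2 w \<and> y \<in> in2 w \<and> mid x w \<noteq> mid y w \<and> mid x w \<noteq> y \<and> mid y w \<noteq> x))"
  shows "card F \<le> (1 + k1 + k2) ^ 5 * m * card W"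
proof -
  interpret G: pair_graph G by fact
  let ?V = "pverts G"
  have arc: "x \<in> ?V" "y \<in> ?V" "x \<noteq> y" if "(x, y) \<in> parcs G" for x y
    using that G.in_arcsD1 G.in_arcsD2 G.pair_no_loops by fastforce+
  have finV: "finite ?V" by (rule G.pair_finite_verts)
  have finW: "finite W" using W finV by (rule finite_subset)
  have finF: "finite F" using FW finW by (meson finite_SigmaI finite_subset)
  have fin1: "finite (in1 v)" for v
    by (rule finite_subset[OF _ finV]) (use in1 arc in blast)
  have fin2: "finite (in2 v)" for v
    by (rule finite_subset[OF _ finV]) (use in1 in2 arc in blast)
  \<comment> \<open>Tag 0 marks a centre, tag 1 joins a vertex of \<open>in1\<close>, tag 2 a vertex
    of \<open>in2\<close>; the second component names the centre.\<close>
  define L where "L u = {(0 :: nat, u)} \<union> Pair 1 ` in1 u \<union> Pair 2 ` in2 u" for u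
  define B where "B \<rho> x = {z \<in> ?V. z = x \<or> \<rho> z = (1 :: nat, x) \<or> (\<rho> z = (2, x) \<and> \<rho> (mid x z) = (1, x))}"
    for \<rho> x
  define good where "good \<rho> x y \<longleftrightarrow> \<rho> x = (0 :: nat, x) \<and> \<rho> y = (0, y) \<and>
    (\<exists>z\<in>B \<rho> x. \<exists>z'\<in>B \<rho> y. (z, z') \<in> parcs G)" for \<rho> x y
  have L: "finite (L u) \<and> L u \<noteq> {} \<and> card (L u) \<le> 1 + k1 + k2" if "u \<in> ?V" for u
  proof -
    have "card (L u) \<le> card {(0 :: nat, u)} + card (Pair (1 :: nat) ` in1 u) + card (Pair (2 :: nat) ` in2 u)"
      unfolding L_def by (intro order_trans[OF card_Un_le] add_right_mono card_Un_le)
    also have "\<dots> \<le> 1 + k1 + k2"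
      using card_image_le[OF fin1, of "Pair (1 :: nat)" u] card_image_le[OF fin2, of "Pair (2 :: nat)" u]
        k1[OF that] k2[OF that] by simp
    finally show ?thesis using fin1 fin2 by (simp add: L_def)
  qed
  have "\<exists>S p. S \<subseteq> ?V \<and> card S \<le> 5 \<and> (\<forall>u\<in>S. p u \<in> L u) \<and>
      (\<forall>\<rho>. (\<forall>u\<in>S. \<rho> u = p u) \<longrightarrow> good \<rho> (fst e) (snd e))" if eF: "e \<in> F" for e
  proof -
    obtain x y where e: "e = (x, y)" by fastforce
    have "x \<noteq> y" "x \<in> ?V" "y \<in> ?V" using F eF FW W unfolding e by blast+
    note xy = this
    consider v where "x \<in> in1 v" "(v, y) \<in> parcs G"
      | w where "x \<in> in2 w" "y \<in> in2 w" "mid x w \<noteq> mid y w" "mid x w \<noteq> y" "mid y w \<noteq> x"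
      using F[OF eF[unfolded e]] by blast
    then show ?thesis
    proof cases
      case 1
      have v: "v \<in> ?V" "v \<noteq> x" "v \<noteq> y" using 1 in1 arc by blast+
      \<comment> \<open>The vertex \<open>v\<close> joins \<open>x\<close>, and its edge to
        \<open>y\<close> links the two branch sets.\<close>
      let ?S = "{x, y, v}"
      let ?p = "(\<lambda>u. (0, u))(v := (1, x))"
      have "card ?S \<le> 5" by (simp add: card_insert_if)
      moreover have "\<forall>u\<in>?S. ?p u \<in> L u" using 1 v by (auto simp: L_def)
      moreover have "good \<rho> x y" if "\<forall>u\<in>?S. \<rho> u = ?p u" for \<rho>
        using that v xy 1(2) unfolding good_def B_def by auto
      ultimately show ?thesis using v xy unfolding e
        by (intro exI[of _ ?S] exI[of _ ?p]) auto
    next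
      case 2
      let ?v = "mid x w" and ?v' = "mid y w"
      have w: "x \<noteq> w" "x \<in> in1 ?v" "w \<in> in1 ?v" "y \<noteq> w" "y \<in> in1 ?v'" "w \<in> in1 ?v'"
        using 2 in2 by blast+
      then have arcs: "(x, ?v) \<in> parcs G" "(w, ?v) \<in> parcs G" "(y, ?v') \<in> parcs G" "(w, ?v') \<in> parcs G"
        using in1 by blast+
      then have ne: "?v \<noteq> x" "?v \<noteq> w" "?v' \<noteq> y" "?v' \<noteq> w" "w \<in> ?V" "?v \<in> ?V" "?v' \<in> ?V"
        using arc[OF arcs(1)] arc[OF arcs(2)] arc[OF arcs(3)] arc[OF arcs(4)] by simp_all
      \<comment> \<open>On the path \<open>x\<close>, \<open>mid x w\<close>, \<open>w\<close>,
        \<open>mid y w\<close>, \<open>y\<close> the first three vertices go to \<open>x\<close> and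
        the last two to \<open>y\<close>; the edge from \<open>w\<close> to \<open>mid y w\<close>
        links them.\<close>
      let ?S = "{x, y, ?v, w, ?v'}"
      let ?p = "(\<lambda>u. (0, u))(?v := (1, x), w := (2, x), ?v' := (1, y))"
      \<comment> \<open>The inequalities among the vertices of the path ensure that no update
        overwrites another role.\<close>
      have p: "?p x = (0, x)" "?p y = (0, y)" "?p ?v = (1, x)" "?p w = (2, x)" "?p ?v' = (1, y)"
        using ne(1-4) w(1,4) 2(3-5) by simp_all
      have c1: "?S \<subseteq> ?V" using ne(5-7) xy(2,3) by simp
      have c2: "card ?S \<le> 5" using card_length[of "[x, y, ?v, w, ?v']"] by simp
      have c3: "\<forall>u\<in>?S. ?p u \<in> L u"
        unfolding ball_simps p using 2(1) w(2,5) by (simp add: L_def)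
      have c4: "good \<rho> x y" if "\<forall>u\<in>?S. \<rho> u = ?p u" for \<rho>
      proof -
        have "\<rho> x = (0, x)" "\<rho> y = (0, y)" "\<rho> ?v = (1, x)" "\<rho> w = (2, x)" "\<rho> ?v' = (1, y)"
          using that unfolding ball_simps p by simp_all
        then show ?thesis unfolding good_def B_def using ne arcs(4) by blast
      qed
      show ?thesis
        unfolding e fst_conv snd_conv
        by (intro exI[of _ ?S] exI[of _ ?p] conjI allI impI) (rule c1, rule c2, rule c3, rule c4)
    qed
  qed
  then obtain S p where Sp: "\<And>e. e \<in> F \<Longrightarrow> S e \<subseteq> ?V \<and> card (S e) \<le> 5 \<and> (\<forall>u\<in>S e. p e u \<in> L u) \<and>
      (\<forall>\<rho>. (\<forall>u\<in>S e. \<rho> u = p e u) \<longrightarrow> good \<rho> (fst e) (snd e))"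
    by metis
  have "\<exists>\<rho>\<in>Pi\<^sub>E ?V L. card F \<le> (1 + k1 + k2) ^ 5 * card {e \<in> F. \<forall>u\<in>S e. \<rho> u = p e u}"
    by (rule ex_assignment_satisfying_many[OF finV L _ finF]) (use Sp in auto)
  then obtain \<rho> where \<rho>: "\<rho> \<in> Pi\<^sub>E ?V L"
    and many: "card F \<le> (1 + k1 + k2) ^ 5 * card {e \<in> F. \<forall>u\<in>S e. \<rho> u = p e u}"
    by blast
  define W' where "W' = {x \<in> W. \<rho> x = (0, x)}"
  define F' where "F' = {e \<in> F. \<forall>u\<in>S e. \<rho> u = p e u}"
  have good: "good \<rho> x y" if "(x, y) \<in> F'" for x y
    using that Sp[of "(x, y)"] by (auto simp: F'_def)
  have \<rho>L: "\<rho> z \<in> L z" if "z \<in> ?V" for z using \<rho> that by (auto simp: PiE_iff)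
  have "card F' \<le> m * card W'"
  proof (rule depth_2_minor_density[OF G m, where B = "B \<rho>"])
    show "x \<in> B \<rho> x \<and> B \<rho> x \<subseteq> ?V" if "x \<in> W'" for x
      using that W by (auto simp: B_def W'_def)
    \<comment> \<open>The second component of its role determines the centre a vertex belongs to, so
      branch sets are disjoint.\<close>
    have "snd (\<rho> z) = x" if "x \<in> W'" "z \<in> B \<rho> x" for x z
      using that by (auto simp: B_def W'_def)
    then show "B \<rho> x \<inter> B \<rho> y = {}" if "x \<in> W'" "y \<in> W'" "x \<noteq> y" for x y
      using that by blast
    show "z = x \<or> (x, z) \<in> parcs G \<or> (\<exists>v\<in>B \<rho> x. (x, v) \<in> parcs G \<and> (v, z) \<in> parcs G)"
      if x: "x \<in> W'" and z: "z \<in> B \<rho> x" for x z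
    proof -
      have zV: "z \<in> ?V" using z by (simp add: B_def)
      consider "z = x" | "\<rho> z = (1, x)" | "\<rho> z = (2, x)" "\<rho> (mid x z) = (1, x)"
        using z by (auto simp: B_def)
      then show ?thesis
      proof cases
        case 2
        then have "x \<in> in1 z" using \<rho>L[OF zV] by (auto simp: L_def)
        then show ?thesis using in1 by blast
      next
        case 3
        then have "x \<in> in2 z" using \<rho>L[OF zV] by (auto simp: L_def)
        then have xz: "(x, mid x z) \<in> parcs G" "(z, mid x z) \<in> parcs G" using in1 in2 by blast+
        then have "mid x z \<in> B \<rho> x" using 3(2) arc(2) by (simp add: B_def)
        then show ?thesis using xz pair_graph_sym[OF G] by blast
      qed simp
    qed
    show "F' \<subseteq> W' \<times> W'"
    proof (rule subrelI)
      fix x y assume xy: "(x, y) \<in> F'"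
      then have "(x, y) \<in> W \<times> W" using FW by (auto simp: F'_def)
      then show "(x, y) \<in> W' \<times> W'" using good[OF xy] by (simp add: W'_def good_def)
    qed
    show "x \<noteq> y \<and> (\<exists>z\<in>B \<rho> x. \<exists>z'\<in>B \<rho> y. (z, z') \<in> parcs G)" if "(x, y) \<in> F'" for x y
      using good[OF that] F[of x y] that unfolding F'_def good_def by blast
  qed
  also have "\<dots> \<le> m * card W" using finW by (auto simp: W'_def intro: card_mono)
  finally have "card F' \<le> m * card W" .
  then have "(1 + k1 + k2) ^ 5 * card F' \<le> (1 + k1 + k2) ^ 5 * (m * card W)"
    by (rule mult_left_mono) simp
  with many show ?thesis unfolding F'_def mult.assoc by (rule order_trans)
qed

section \<open>The two orders and the colouring that make out-neighbourhoods laminar\<close>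

text \<open>One greedy colouring serves the union of three sparse graphs: \<open>G\<close>, the
  pairs joined by two edges the first of which goes up in \<open>f1\<close>, and the fraternal graph
  of the second orientation. The last separation property is the source of laminarity.\<close>

lemma ex_laminar_coloring:
  fixes G :: "'a pair_pre_digraph" and m :: nat
  defines "d2 \<equiv> 2 * ((1 + m) ^ 5 * m)"
  defines "d3 \<equiv> (1 + m + d2) ^ 5 * m"
  assumes G: "pair_graph G" and m: "nabla 2 G \<le> real m"
  obtains f1 f2 c :: "'a \<Rightarrow> nat"
  where "inj_on f1 (pverts G)" "inj_on f2 (pverts G)"
    "\<And>x. x \<in> pverts G \<Longrightarrow> c x \<le> m + d2 + d3"
    "\<And>x y. (x, y) \<in> parcs G \<Longrightarrow> c x \<noteq> c y"
    "\<And>x v y. x \<noteq> y \<Longrightarrow> (x, v) \<in> parcs G \<Longrightarrow> f1 x < f1 v \<Longrightarrow> (v, y) \<in> parcs G \<Longrightarrow> c x \<noteq> c y"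
    "\<And>x y v v' w. x \<noteq> y \<Longrightarrow> f2 x < f2 w \<Longrightarrow> f2 y < f2 w \<Longrightarrow>
       (x, v) \<in> parcs G \<Longrightarrow> f1 x < f1 v \<Longrightarrow> (w, v) \<in> parcs G \<Longrightarrow> f1 w < f1 v \<Longrightarrow>
       (y, v') \<in> parcs G \<Longrightarrow> f1 y < f1 v' \<Longrightarrow> (w, v') \<in> parcs G \<Longrightarrow> f1 w < f1 v' \<Longrightarrow> c x \<noteq> c y"
proof -
  interpret G: pair_graph G by fact
  let ?V = "pverts G" and ?E = "parcs G"
  have arc: "x \<in> ?V" "y \<in> ?V" "x \<noteq> y" if "(x, y) \<in> ?E" for x y
    using that G.in_arcsD1 G.in_arcsD2 G.pair_no_loops by fastforce+
  have finV: "finite ?V" by (rule G.pair_finite_verts)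
  have symE: "sym ?E" by (rule symI) (rule pair_graph_sym[OF G])
  \<comment> \<open>With singleton branch sets the edges within \<open>W\<close> themselves form the
    minor.\<close>
  have E_density: "card (?E \<inter> W \<times> W) \<le> m * card W" if "W \<subseteq> ?V" for W
    by (rule depth_2_minor_density[OF G m, where B = "\<lambda>x. {x}"]) (use that arc in auto)
  obtain f1 :: "'a \<Rightarrow> nat" where f1: "inj_on f1 ?V"
    "\<forall>x\<in>?V. card {y \<in> ?V. (y, x) \<in> ?E \<and> f1 y < f1 x} \<le> m"
    using degenerate_order[OF finV E_density] by blast
  define in1 where "in1 v = {x. (x, v) \<in> ?E \<and> f1 x < f1 v}" for v
  have in1: "(x, v) \<in> ?E" if "x \<in> in1 v" for x v using that by (simp add: in1_def)
  have in1_card: "card (in1 v) \<le> m" if "v \<in> ?V" for v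
  proof -
    have "in1 v = {y \<in> ?V. (y, v) \<in> ?E \<and> f1 y < f1 v}" using arc by (auto simp: in1_def)
    then show ?thesis using f1(2) that by simp
  qed
  \<comment> \<open>Besides the fraternal pairs, with two arcs into \<open>v\<close>, this contains
    the pairs joined by a directed path through \<open>v\<close>.\<close>
  define Q where "Q = {(x, y). x \<noteq> y \<and> (\<exists>v. x \<in> in1 v \<and> (v, y) \<in> ?E)}"
  define R where "R = Q \<union> Q\<inverse>"
  have symR: "sym R" by (auto simp: R_def intro: symI)
  have R_density: "card (R \<inter> W \<times> W) \<le> d2 * card W" if W: "W \<subseteq> ?V" for W
  proof -
    \<comment> \<open>An empty \<open>in2\<close> leaves only connections through a single vertex.
      The factor 2 in \<open>d2\<close> comes from symmetrizing \<open>Q\<close>.\<close>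
    have "card (Q \<inter> W \<times> W) \<le> (1 + m + 0) ^ 5 * m * card W"
      by (rule density_of_augmentation[OF G m in1 in1_card _ _ W, where ?in2.0 = "\<lambda>_. {}" and ?k2.0 = 0])
        (auto simp: Q_def)
    moreover have "R \<inter> W \<times> W = Q \<inter> W \<times> W \<union> (Q \<inter> W \<times> W)\<inverse>" by (auto simp: R_def)
    ultimately show ?thesis
      using card_Un_le[of "Q \<inter> W \<times> W" "(Q \<inter> W \<times> W)\<inverse>"] by (simp add: d2_def algebra_simps)
  qed
  obtain f2 :: "'a \<Rightarrow> nat" where f2: "inj_on f2 ?V"
    "\<forall>x\<in>?V. card {y \<in> ?V. (y, x) \<in> R \<and> f2 y < f2 x} \<le> d2"
    using degenerate_order[OF finV R_density] by blast
  define in2 where "in2 w = {x. f2 x < f2 w \<and> (\<exists>v. x \<in> in1 v \<and> w \<in> in1 v)}" for w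
  define mid where "mid x w = (SOME v. x \<in> in1 v \<and> w \<in> in1 v)" for x w
  have in2: "x \<noteq> w \<and> x \<in> in1 (mid x w) \<and> w \<in> in1 (mid x w)" if "x \<in> in2 w" for x w
  proof -
    have "\<exists>v. x \<in> in1 v \<and> w \<in> in1 v" "x \<noteq> w" using that by (auto simp: in2_def)
    then show ?thesis unfolding mid_def by (metis (mono_tags, lifting) someI_ex)
  qed
  have fraternal: "(x, y) \<in> Q" if "x \<in> in1 v" "y \<in> in1 v" "x \<noteq> y" for x y v
    using that in1 pair_graph_sym[OF G] by (auto simp: Q_def)
  have in2_card: "card (in2 w) \<le> d2" if "w \<in> ?V" for w
  proof -
    have "in2 w \<subseteq> {y \<in> ?V. (y, w) \<in> R \<and> f2 y < f2 w}"
      using in1 arc fraternal by (fastforce simp: in2_def R_def)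
    then have "card (in2 w) \<le> card {y \<in> ?V. (y, w) \<in> R \<and> f2 y < f2 w}"
      using finV by (intro card_mono) auto
    also have "\<dots> \<le> d2" using f2(2) that by blast
    finally show ?thesis .
  qed
  \<comment> \<open>Removing \<open>?E\<close> and \<open>R\<close> keeps the connecting vertices
    distinct from each other and from the opposite ends: any coincidence would make the pair an edge
    or fraternal.\<close>
  define T where "T = {(x, y). x \<noteq> y \<and> (\<exists>w. x \<in> in2 w \<and> y \<in> in2 w)} - ?E - R"
  have symT: "sym T"
    by (rule symI) (use symD[OF symE] symD[OF symR] in \<open>auto simp: T_def\<close>)
  have T_density: "card (T \<inter> W \<times> W) \<le> d3 * card W" if W: "W \<subseteq> ?V" for W
    unfolding d3_def
  proof (rule density_of_augmentation[OF G m in1 in1_card in2 in2_card W])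
    fix x y assume "(x, y) \<in> T \<inter> W \<times> W"
    then have xy: "x \<noteq> y" "(x, y) \<notin> ?E" "(x, y) \<notin> R" by (auto simp: T_def)
    obtain w where w: "x \<in> in2 w" "y \<in> in2 w"
      using \<open>(x, y) \<in> T \<inter> W \<times> W\<close> by (auto simp: T_def)
    have v: "x \<in> in1 (mid x w)" "y \<in> in1 (mid y w)" using w in2 by blast+
    have "mid x w \<noteq> mid y w" using fraternal[of x "mid x w" y] v xy by (auto simp: R_def)
    moreover have "mid x w \<noteq> y" using in1[OF v(1)] xy by auto
    moreover have "mid y w \<noteq> x" using pair_graph_sym[OF G in1[OF v(2)]] xy by auto
    ultimately show "x \<noteq> y \<and> ((\<exists>v. x \<in> in1 v \<and> (v, y) \<in> ?E) \<or>
       (\<exists>w. x \<in> in2 w \<and> y \<in> in2 w \<and> mid x w \<noteq> mid y w \<and> mid x w \<noteq> y \<and> mid y w \<noteq> x))"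
      using xy(1) w by blast
  qed auto
  have "card ((?E \<union> R \<union> T) \<inter> W \<times> W) \<le> (m + d2 + d3) * card W" if W: "W \<subseteq> ?V" for W
  proof -
    have "(?E \<union> R \<union> T) \<inter> W \<times> W = ?E \<inter> W \<times> W \<union> R \<inter> W \<times> W \<union> T \<inter> W \<times> W" by auto
    then have "card ((?E \<union> R \<union> T) \<inter> W \<times> W) \<le> card (?E \<inter> W \<times> W) + card (R \<inter> W \<times> W) + card (T \<inter> W \<times> W)"
      by (metis card_Un_le add_right_mono order_trans)
    then show ?thesis
      using E_density[OF W] R_density[OF W] T_density[OF W] by (simp add: algebra_simps)
  qed
  then obtain c :: "'a \<Rightarrow> nat" where c: "\<forall>x\<in>?V. c x \<le> m + d2 + d3"
    "\<forall>x\<in>?V. \<forall>y\<in>?V. x \<noteq> y \<longrightarrow> (x, y) \<in> ?E \<union> R \<union> T \<longrightarrow> c x \<noteq> c y"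
    using degenerate_coloring[OF finV, of "?E \<union> R \<union> T"] symE symR symT sym_Un by metis
  show thesis
  proof (rule that[of f1 f2 c])
    show "inj_on f1 ?V" "inj_on f2 ?V" by fact+
    show "c x \<le> m + d2 + d3" if "x \<in> ?V" for x using c(1) that by blast
    show "c x \<noteq> c y" if "(x, y) \<in> ?E" for x y using c(2) that arc[OF that] by blast
    show "c x \<noteq> c y" if "x \<noteq> y" "(x, v) \<in> ?E" "f1 x < f1 v" "(v, y) \<in> ?E" for x v y
    proof -
      have "(x, y) \<in> R" using that by (auto simp: R_def Q_def in1_def)
      then show ?thesis using c(2) that(1) arc[OF that(2)] arc[OF that(4)] by blast
    qed
    show "c x \<noteq> c y" if "x \<noteq> y" "f2 x < f2 w" "f2 y < f2 w" "(x, v) \<in> ?E" "f1 x < f1 v"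
       "(w, v) \<in> ?E" "f1 w < f1 v" "(y, v') \<in> ?E" "f1 y < f1 v'" "(w, v') \<in> ?E" "f1 w < f1 v'"
     for x y v v' w
    proof -
      have "x \<in> in2 w" "y \<in> in2 w" using that by (auto simp: in2_def in1_def)
      then have "(x, y) \<in> ?E \<union> R \<union> T" using that(1) by (auto simp: T_def)
      then show ?thesis using c(2) that(1) arc[OF that(4)] arc[OF that(8)] by blast
    qed
  qed
qed

section \<open>From the laminar colouring to a strong odd colouring\<close>

text \<open>The factors of the bound are the ranges of \<open>c v\<close>, of the sorted list of
  colours of in-neighbours, and of the splitting colour. The lists have at most \<open>Suc K\<close>
  entries because their entries are distinct.\<close>

lemma strong_odd_chromatic_number_le_of_laminar_coloring:
  fixes G :: "'a pair_pre_digraph" and f1 f2 c :: "'a \<Rightarrow> nat"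
  assumes G: "pair_graph G" and f1: "inj_on f1 (pverts G)" and f2: "inj_on f2 (pverts G)"
    and cK: "\<And>x. x \<in> pverts G \<Longrightarrow> c x \<le> K"
    and proper: "\<And>x y. (x, y) \<in> parcs G \<Longrightarrow> c x \<noteq> c y"
    and path: "\<And>x v y. x \<noteq> y \<Longrightarrow> (x, v) \<in> parcs G \<Longrightarrow> f1 x < f1 v \<Longrightarrow> (v, y) \<in> parcs G \<Longrightarrow> c x \<noteq> c y"
    and laminar: "\<And>x y v v' w. x \<noteq> y \<Longrightarrow> f2 x < f2 w \<Longrightarrow> f2 y < f2 w \<Longrightarrow>
       (x, v) \<in> parcs G \<Longrightarrow> f1 x < f1 v \<Longrightarrow> (w, v) \<in> parcs G \<Longrightarrow> f1 w < f1 v \<Longrightarrow>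
       (y, v') \<in> parcs G \<Longrightarrow> f1 y < f1 v' \<Longrightarrow> (w, v') \<in> parcs G \<Longrightarrow> f1 w < f1 v' \<Longrightarrow> c x \<noteq> c y"
  shows "strong_odd_chromatic_number G
    \<le> card ({..K} \<times> {l. set l \<subseteq> {..K} \<and> length l \<le> Suc K} \<times> {..<2 ^ Suc K :: nat})"
proof -
  interpret G: pair_graph G by fact
  let ?V = "pverts G" and ?E = "parcs G"
  have arc: "x \<in> ?V" "y \<in> ?V" "x \<noteq> y" if "(x, y) \<in> ?E" for x y
    using that G.in_arcsD1 G.in_arcsD2 G.pair_no_loops by fastforce+
  have finV: "finite ?V" by (rule G.pair_finite_verts)
  define in1 where "in1 v = {x. (x, v) \<in> ?E \<and> f1 x < f1 v}" for v
  have in1V: "in1 v \<subseteq> ?V" for v using arc by (auto simp: in1_def)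
  have fin1: "finite (in1 v)" for v using in1V finV by (rule finite_subset)
  define g where "g = the_inv_into ?V f2"
  have g: "g (f2 x) = x" if "x \<in> ?V" for x using that f2 by (simp add: g_def the_inv_into_f_f)
  \<comment> \<open>In-neighbours are listed by their \<open>f2\<close>-values, which can be sorted;
    \<open>g\<close> translates back to vertices.\<close>
  define ns where "ns v = sorted_list_of_set (f2 ` in1 v)" for v
  define cs where "cs v = map (\<lambda>n. c (g n)) (ns v)" for v
  have set_ns: "set (ns v) = f2 ` in1 v" for v using fin1 by (simp add: ns_def)
  have ns_less: "ns v ! i < ns v ! j" if "i < j" "j < length (ns v)" for v i j
    using that strict_sorted_list_of_set[of "f2 ` in1 v"]
    by (simp add: ns_def sorted_wrt_nth_less)
  have len_cs: "length (cs v) = length (ns v)" for v by (simp add: cs_def)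
  have nth_in1: "g (ns v ! i) \<in> in1 v" "f2 (g (ns v ! i)) = ns v ! i"
    "cs v ! i = c (g (ns v ! i))" if "i < length (ns v)" for v i
  proof -
    have "ns v ! i \<in> f2 ` in1 v" using that set_ns nth_mem by blast
    then obtain x where x: "x \<in> in1 v" "ns v ! i = f2 x" by blast
    then have "g (f2 x) = x" using g in1V by blast
    then show "g (ns v ! i) \<in> in1 v" "f2 (g (ns v ! i)) = ns v ! i" using x by simp_all
  qed (use that in \<open>simp add: cs_def\<close>)
  \<comment> \<open>Two in-neighbours of \<open>v\<close> are joined by a path through
    \<open>v\<close> whose first edge goes up in \<open>f1\<close>, so \<open>path\<close> separates
    them.\<close>
  have c_inj: "inj_on c (in1 v)" for v
  proof (rule inj_onI, rule ccontr)
    fix x y assume xy: "x \<in> in1 v" "y \<in> in1 v" "c x = c y" "x \<noteq> y"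
    then have "(v, y) \<in> ?E" using pair_graph_sym[OF G] by (simp add: in1_def)
    then show False using path[of x y v] xy by (simp add: in1_def)
  qed
  have distinct_cs: "distinct (cs v)" for v
    unfolding cs_def distinct_map
  proof
    show "distinct (ns v)" by (simp add: ns_def)
    show "inj_on (\<lambda>n. c (g n)) (set (ns v))"
    proof (rule inj_onI)
      fix a b assume ab: "a \<in> set (ns v)" "b \<in> set (ns v)" "c (g a) = c (g b)"
      then obtain i j where "i < length (ns v)" "a = ns v ! i" "j < length (ns v)" "b = ns v ! j"
        by (auto simp: in_set_conv_nth)
      then show "a = b" using ab(3) nth_in1[of i v] nth_in1[of j v] inj_onD[OF c_inj] by metis
    qed
  qed
  have cs_K: "set (cs v) \<subseteq> {..K}" for v
    using nth_in1(1) in1V cK by (fastforce simp: cs_def in_set_conv_nth)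
  have len_K: "length (cs v) \<le> Suc K" for v
    using card_mono[OF _ cs_K[of v]] distinct_card[OF distinct_cs[of v]] by simp
  define A where "A t = {v \<in> ?V. (c v, cs v) = t}" for t
  \<comment> \<open>Later positions give finer functions; \<open>f2\<close> is appended so that the
    chain ends with an injective one.\<close>
  define gs where "gs t = map (\<lambda>j v. ns v ! j) [0..<length (snd t)] @ [f2]" for t :: "nat \<times> nat list"
  define is_odd where "is_odd t h \<longleftrightarrow> (\<forall>x\<in>A t. h x < 2 ^ (length (gs t) - 1)) \<and>
      (\<forall>g\<in>set (gs t). \<forall>u i.
        {x \<in> A t. g x = u \<and> h x = i} = {} \<or> odd (card {x \<in> A t. g x = u \<and> h x = i}))"
    for t and h :: "'a \<Rightarrow> nat"
  have "\<exists>h. is_odd t h" for t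
    unfolding is_odd_def
  proof (rule odd_partition_of_refining_chain)
    show "finite (A t)" using finV by (simp add: A_def)
    show "inj_on (last (gs t)) (A t)" using f2 by (auto simp: gs_def A_def inj_on_def)
    have "refines_on (A t) (\<lambda>v. ns v ! i) (\<lambda>v. ns v ! j)" if ij: "i < j" "j < length (snd t)" for i j
      unfolding refines_on_def
    proof (intro ballI impI)
      fix v v' assume v: "v \<in> A t" "v' \<in> A t" and eq: "ns v ! j = ns v' ! j"
      have cs_eq: "cs v = snd t" "cs v' = snd t" using v by (auto simp: A_def)
      then have len: "j < length (ns v)" "j < length (ns v')" using ij len_cs by metis+
      then have len': "i < length (ns v)" "i < length (ns v')" using ij by auto
      \<comment> \<open>\<open>?x\<close> and \<open>?y\<close> both precede the common in-neighbour
        \<open>?w\<close> and have equal colours because the types agree, so \<open>laminar\<close>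
        forces them to coincide.\<close>
      let ?x = "g (ns v ! i)" and ?y = "g (ns v' ! i)" and ?w = "g (ns v ! j)"
      have "?x \<in> in1 v" "?y \<in> in1 v'" "?w \<in> in1 v" "?w \<in> in1 v'"
        using nth_in1(1)[OF len(1)] nth_in1(1)[OF len(2)] nth_in1(1)[OF len'(1)]
          nth_in1(1)[OF len'(2)] eq by simp_all
      moreover have "f2 ?x < f2 ?w" "f2 ?y < f2 ?w"
        using ns_less[OF ij(1) len(1)] ns_less[OF ij(1) len(2)] nth_in1(2) len len' eq by simp_all
      moreover have "c ?x = c ?y" using nth_in1(3) len' cs_eq by metis
      ultimately have "?x = ?y" using laminar[of ?x ?y ?w v v'] by (auto simp: in1_def)
      then show "ns v ! i = ns v' ! i" using nth_in1(2) len' by metis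
    qed
    then have "sorted_wrt (refines_on (A t)) (map (\<lambda>j v. ns v ! j) [0..<length (snd t)])"
      by (simp add: sorted_wrt_iff_nth_less)
    moreover have "refines_on (A t) g' f2" for g' :: "'a \<Rightarrow> nat"
      using f2 by (auto simp: refines_on_def A_def inj_on_def)
    ultimately show "sorted_wrt (refines_on (A t)) (gs t)"
      by (simp add: gs_def sorted_wrt_append)
  qed (simp add: gs_def)
  then obtain h :: "nat \<times> nat list \<Rightarrow> 'a \<Rightarrow> nat" where h: "\<And>t. is_odd t (h t)" by metis
  let ?P = "{..K} \<times> {l. set l \<subseteq> {..K} \<and> length l \<le> Suc K} \<times> {..<2 ^ Suc K :: nat}"
  \<comment> \<open>Palettes consist of natural numbers, hence the encoding of the triple.\<close>
  define \<phi> where "\<phi> v = to_nat (c v, cs v, h (c v, cs v) v)" for v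
  have finP: "finite ?P" by (simp add: finite_lists_length_le)
  have "h (c v, cs v) v < 2 ^ Suc K" if "v \<in> ?V" for v
  proof -
    have "h (c v, cs v) v < 2 ^ length (cs v)"
      using h[of "(c v, cs v)"] that by (simp add: is_odd_def A_def gs_def)
    also have "\<dots> \<le> 2 ^ Suc K" using len_K by (intro power_increasing) auto
    finally show ?thesis .
  qed
  then have \<phi>P: "\<phi> \<in> ?V \<rightarrow> to_nat ` ?P"
    using cK cs_K len_K by (fastforce simp: \<phi>_def)
  have \<phi>_eq: "\<phi> v = to_nat (a, l, k) \<longleftrightarrow> c v = a \<and> cs v = l \<and> h (a, l) v = k" for v a l k
    by (auto simp: \<phi>_def inj_eq[OF inj_to_nat])
  have odd: "{v \<in> neighbors G u. \<phi> v = to_nat (a, l, k)} = {} \<or>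
      odd (card {v \<in> neighbors G u. \<phi> v = to_nat (a, l, k)})" (is "?N = {} \<or> _")
    for u and a k :: nat and l :: "nat list"
  \<comment> \<open>If the class contains an in-neighbour of \<open>u\<close>, then
    \<open>path\<close> excludes every other member; otherwise \<open>u\<close> is an in-neighbour
    of all members.\<close>
  proof (cases "\<exists>v\<in>?N. f1 v < f1 u")
    case True
    then obtain v where v: "v \<in> ?N" "f1 v < f1 u" by blast
    have "y = v" if "y \<in> ?N" for y
    proof (rule ccontr)
      assume "y \<noteq> v"
      moreover have "(v, u) \<in> ?E" "(u, y) \<in> ?E"
        using v that pair_graph_sym[OF G] by (auto simp: neighbors_def)
      moreover have "c v = c y" using v(1) that by (auto simp: \<phi>_eq)
      ultimately show False using path[of v y u] v(2) by auto
    qed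
    then have "?N = {v}" using v(1) by blast
    then show ?thesis by simp
  next
    case False
    have below: "u \<in> in1 v" if "v \<in> ?N" for v
    proof -
      have uv: "(u, v) \<in> ?E" using that by (simp add: neighbors_def)
      then have "f1 u \<noteq> f1 v" using f1 arc[OF uv] by (auto dest: inj_onD)
      then show ?thesis using uv False that by (force simp: in1_def)
    qed
    have pos: "\<exists>j<length l. ns v ! j = f2 u \<and> l ! j = c u" if v: "v \<in> ?N" for v
    proof -
      have l: "cs v = l" using v by (simp add: \<phi>_eq)
      have "f2 u \<in> set (ns v)" using below[OF v] set_ns by blast
      then obtain j where j: "j < length (ns v)" "ns v ! j = f2 u" by (auto simp: in_set_conv_nth)
      moreover have "g (f2 u) = u" using g below[OF v] in1V by blast
      ultimately show ?thesis using nth_in1(3)[OF j(1)] l len_cs by metis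
    qed
    show ?thesis
    proof (cases "?N = {}")
      case False
      then obtain v0 where v0: "v0 \<in> ?N" by blast
      have dl: "distinct l" using v0 distinct_cs[of v0] by (auto simp: \<phi>_eq)
      obtain j where j: "j < length l" "l ! j = c u" using pos[OF v0] by blast
      \<comment> \<open>Since \<open>l\<close> has distinct entries, the colour of \<open>u\<close>
        fixes its position \<open>j\<close> for all members. The class is thus a fibre of one
        function of the chain within one splitting colour.\<close>
      have "?N = {v \<in> A (a, l). ns v ! j = f2 u \<and> h (a, l) v = k}"
      proof (intro set_eqI iffI)
        fix v assume v: "v \<in> ?N"
        then obtain j' where j': "j' < length l" "ns v ! j' = f2 u" "l ! j' = c u" using pos by blast
        then have "j' = j" using j dl nth_eq_iff_index_eq by metis
        then show "v \<in> {v \<in> A (a, l). ns v ! j = f2 u \<and> h (a, l) v = k}"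
          using v j' arc(2) by (auto simp: A_def \<phi>_eq neighbors_def)
      next
        fix v assume v: "v \<in> {v \<in> A (a, l). ns v ! j = f2 u \<and> h (a, l) v = k}"
        then have cv: "c v = a" "cs v = l" "ns v ! j = f2 u" "h (a, l) v = k" by (auto simp: A_def)
        then have jv: "j < length (ns v)" using j len_cs by metis
        have "u \<in> ?V" using below[OF v0] in1V by blast
        then have "u \<in> in1 v" using nth_in1(1)[OF jv] cv(3) g by simp
        then show "v \<in> ?N" using cv by (simp add: in1_def neighbors_def \<phi>_eq)
      qed
      moreover have "(\<lambda>v. ns v ! j) \<in> set (gs (a, l))" using j by (auto simp: gs_def)
      then have "{v \<in> A (a, l). ns v ! j = f2 u \<and> h (a, l) v = k} = {} \<or>
          odd (card {v \<in> A (a, l). ns v ! j = f2 u \<and> h (a, l) v = k})"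
        by (rule conjunct2[OF h[of "(a, l)", unfolded is_odd_def], THEN bspec, THEN spec, THEN spec])
      ultimately show ?thesis by (simp only:)
    qed simp
  qed
  have "strong_odd_coloring G (to_nat ` ?P) \<phi>"
    unfolding strong_odd_coloring_def proper_coloring_def
  proof (intro conjI ballI)
    show "finite (to_nat ` ?P)" using finP by (rule finite_imageI)
    show "\<phi> \<in> ?V \<rightarrow> to_nat ` ?P" by (fact \<phi>P)
    show "case a of (u, v) \<Rightarrow> \<phi> u \<noteq> \<phi> v" if "a \<in> ?E" for a
      using proper that by (auto simp: \<phi>_def inj_eq[OF inj_to_nat])
    fix u i assume "i \<in> to_nat ` ?P"
    then obtain a k :: nat and l :: "nat list" where "i = to_nat (a, l, k)" by auto
    then show "card {v \<in> neighbors G u. \<phi> v = i} = 0 \<or> odd (card {v \<in> neighbors G u. \<phi> v = i})"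
      using odd[of u a l k] card.empty by metis
  qed
  moreover have "card (to_nat ` ?P) \<le> card ?P" using finP by (rule card_image_le)
  ultimately show ?thesis unfolding strong_odd_chromatic_number_le_iff[OF G] by blast
qed

theorem theorem1p1:
  fixes \<C> :: "'a pair_pre_digraph set"
  assumes "\<forall>G \<in> \<C>. pair_graph G"
    and "bounded_expansion \<C>"
  shows "\<exists>c :: nat. \<forall>G \<in> \<C>. strong_odd_chromatic_number G \<le> c"
proof -
  obtain b :: real where b: "\<forall>G\<in>\<C>. nabla 2 G \<le> b"
    using assms(2) unfolding bounded_expansion_def by blast
  obtain m :: nat where "b \<le> real m" using real_arch_simple by blast
  then have m: "nabla 2 G \<le> real m" if "G \<in> \<C>" for G using b that by fastforce
  \<comment> \<open>These are the constants of \<open>ex_laminar_coloring\<close>; they depend on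
    \<open>m\<close> alone, so the bound is uniform over the class.\<close>
  define d2 where "d2 = 2 * ((1 + m) ^ 5 * m)"
  define K where "K = m + d2 + (1 + m + d2) ^ 5 * m"
  have "strong_odd_chromatic_number G
      \<le> card ({..K} \<times> {l. set l \<subseteq> {..K} \<and> length l \<le> Suc K} \<times> {..<2 ^ Suc K :: nat})"
    if "G \<in> \<C>" for G
  proof -
    have G: "pair_graph G" "nabla 2 G \<le> real m" using assms(1) m that by blast+
    show ?thesis
      by (rule ex_laminar_coloring[OF G, folded d2_def, folded K_def],
          rule strong_odd_chromatic_number_le_of_laminar_coloring[OF G(1)])
  qed
  then show ?thesis by blast
qed

end
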